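(* For every sequence $\mathbf{x}=\{x_k\}_{k\geq 1}$ of points in the unit circle $\mathbb{T}=\mathbb{R}/\mathbb{Z}$, the inequality $d_n(\mathbf{x})\leq \phi_{n-1}$ holds for infinitely many integers $n\geq 2$, where $d_n(\mathbf{x})=\min_{1\leq r<s\leq n}\rho(x_r,x_s)$ for $n\geq 2$ and $\phi_m=\frac{\ln(m+1)-\ln m}{2\ln 2}$ for $m\geq 1$.
   Context: $\mathbb{T}=\mathbb{R}/\mathbb{Z}$ is the unit circle with its standard metric $\rho(s,t)=\mathrm{dist}(s-t,\mathbb{Z})$, i.e. the distance from (any real representative of) $s-t$ to the nearest integer. Sequences are indexed by the integers $k\geq 1$; the terms of the sequence are not assumed to be distinct. *)

theory Defs
  imports "HOL-Analysis.Analysis"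
begin

quotient_type circle = real / "\<lambda>s t :: real. s - t \<in> \<int>"
proof (rule equivpI)
  show "reflp (\<lambda>s t :: real. s - t \<in> \<int>)"
    by (simp add: reflp_def)
  show "symp (\<lambda>s t :: real. s - t \<in> \<int>)"
    unfolding symp_def by (metis Ints_minus minus_diff_eq)
  show "transp (\<lambda>s t :: real. s - t \<in> \<int>)"
    unfolding transp_def by (metis Ints_add diff_add_cancel add_diff_eq)
qed

lemma infdist_Ints_cong:
  fixes u v :: real
  assumes "u - v \<in> \<int>"
  shows "infdist u \<int> = infdist v \<int>"
proof -
  have le: "infdist a \<int> \<le> infdist b \<int>" if "a - b \<in> \<int>" for a b :: real
  proof -
    have "infdist a \<int> \<le> dist b k" if "k \<in> \<int>" for k
    proof -
      have "k + (a - b) \<in> \<int>" using that \<open>a - b \<in> \<int>\<close> by simp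
      then have "infdist a \<int> \<le> dist a (k + (a - b))" by (rule infdist_le)
      then show ?thesis by (simp add: dist_real_def)
    qed
    then have "infdist a \<int> \<le> (INF k\<in>\<int>. dist b k)"
      by (intro cINF_greatest) auto
    then show ?thesis
      by (subst (2) infdist_notempty) auto
  qed
  have "v - u \<in> \<int>" using assms by (metis Ints_minus minus_diff_eq)
  then show ?thesis using le assms by (meson order_antisym)
qed

lift_definition rho :: "circle \<Rightarrow> circle \<Rightarrow> real"
  is "\<lambda>s t. infdist (s - t) \<int>"
proof -
  fix s s' t t' :: real
  assume "s - s' \<in> \<int>" "t - t' \<in> \<int>"
  then have "(s - s') - (t - t') \<in> \<int>" by (rule Ints_diff)
  then have "(s - t) - (s' - t') \<in> \<int>" by (simp add: algebra_simps)
  then show "infdist (s - t) \<int> = infdist (s' - t') \<int>" by (rule infdist_Ints_cong)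
qed

text \<open>Sequences are indexed from 1; the value at index 0 is never used.
  The minimum is over a nonempty set only for \<open>n \<ge> 2\<close>.\<close>

definition min_gap :: "(nat \<Rightarrow> circle) \<Rightarrow> nat \<Rightarrow> real" where
  "min_gap x n = Min {rho (x r) (x s) | r s. 1 \<le> r \<and> r < s \<and> s \<le> n}"

definition phi :: "nat \<Rightarrow> real" where
  "phi m = (ln (real m + 1) - ln (real m)) / (2 * ln 2)"

end

theory Submission
  imports Defs
begin

text \<open>Order \<open>2n\<close> points cyclically. If \<open>d\<^sub>k > \<phi>\<^sub>k\<^sub>-\<^sub>1\<close> for all \<open>k > n\<close>, then the arc between
  neighbours \<open>x\<^sub>a, x\<^sub>b\<close> is longer than \<open>\<phi>\<^sub>K\<^sub>-\<^sub>1\<close> with \<open>K = max a b (n + 1)\<close>. Put \<open>t = \<phi>\<^sub>n\<close> and give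
  the index \<open>k\<close> the weight \<open>h k = t/2\<close> if \<open>k \<le> n\<close> and \<open>h k = \<phi>\<^sub>k\<^sub>-\<^sub>1 - t/2\<close> if \<open>k > n\<close>. As \<open>\<phi>\<close> is
  decreasing, \<open>\<phi>\<^sub>K\<^sub>-\<^sub>1 \<ge> h a + h b\<close>. Every point is an end of two arcs and the arcs add up to
  \<open>1\<close>, so twice the sum of all weights is less than \<open>1\<close>; but this number is
  \<open>2 (\<phi>\<^sub>n + \<dots> + \<phi>\<^sub>2\<^sub>n\<^sub>-\<^sub>1) = log\<^sub>2 (2n / n) = 1\<close>.\<close>

lemma rho_commute: "rho a b = rho b a"
proof (transfer)
  have le: "infdist (- u) \<int> \<le> infdist u \<int>" for u :: real
  proof -
    have "infdist (- u) \<int> \<le> dist u k" if "k \<in> \<int>" for k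
      using infdist_le[of "- k" \<int> "- u"] that by (simp add: dist_minus)
    then have "infdist (- u) \<int> \<le> (INF k\<in>\<int>. dist u k)"
      by (intro cINF_greatest) auto
    then show ?thesis
      by (subst (2) infdist_notempty) auto
  qed
  show "infdist (a - b) \<int> = infdist (b - a) \<int>" for a b :: real
    using le[of "a - b"] le[of "b - a"] by simp
qed

lemma circle_representative:
  obtains u where "0 \<le> u" "u < 1" "c = abs_circle u"
proof -
  obtain v where v: "c = abs_circle v"
    by (induction c rule: circle.abs_induct) auto
  have "v - frac v \<in> \<int>"
    by (simp add: frac_def)
  then have "c = abs_circle (frac v)"
    by (simp add: v circle.abs_eq_iff)
  then show ?thesis
    using that[of "frac v"] by (simp add: frac_lt_1)
qed

lemma rho_abs_circle_le:
  assumes "m \<in> \<int>"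
  shows "rho (abs_circle u) (abs_circle v) \<le> \<bar>u - v - m\<bar>"
  using infdist_le[OF assms, of "u - v"] by (simp add: rho.abs_eq dist_real_def)

text \<open>Adding the bounds for consecutive entries telescopes the distances. Inner weights occur
  twice but the two end weights only once, whence the correction
  \<open>h a + h (last (a # L))\<close>.\<close>

lemma sum_list_weights_le_sorted:
  fixes f h :: "'a \<Rightarrow> real"
  assumes "sorted (map f (a # L))" "distinct (a # L)"
    and "\<And>b c. b \<in> set (a # L) \<Longrightarrow> c \<in> set (a # L) \<Longrightarrow> b \<noteq> c \<Longrightarrow> h b + h c \<le> \<bar>f b - f c\<bar>"
  shows "2 * sum_list (map h (a # L)) \<le> f (last (a # L)) - f a + h a + h (last (a # L))"
  using assms
proof (induction L arbitrary: a)
  case (Cons b L)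
  have "2 * sum_list (map h (b # L)) \<le> f (last (b # L)) - f b + h b + h (last (b # L))"
    using Cons.prems by (intro Cons.IH) auto
  moreover have "h a + h b \<le> f b - f a"
    using Cons.prems(1,2) Cons.prems(3)[of a b] by auto
  ultimately show ?case
    by simp
qed simp

lemma sum_weights_less_of_rho:
  fixes h :: "'a :: linorder \<Rightarrow> real"
  assumes "finite A" "card A \<ge> 2"
    and less: "\<And>a b. a \<in> A \<Longrightarrow> b \<in> A \<Longrightarrow> a \<noteq> b \<Longrightarrow> h a + h b < rho (x a) (x b)"
  shows "2 * (\<Sum>a\<in>A. h a) < 1"
proof -
  have "\<exists>u. 0 \<le> u \<and> u < 1 \<and> x k = abs_circle u" for k
    using circle_representative by metis
  then obtain f where f: "\<And>k. 0 \<le> f k" "\<And>k. f k < 1" "\<And>k. x k = abs_circle (f k)"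
    by metis
  define L where "L = sort_key f (sorted_list_of_set A)"
  have L: "sorted (map f L)" "distinct L" "set L = A"
    using assms(1) by (simp_all add: L_def)
  have "length L \<ge> 2"
    using L assms(2) distinct_card by metis
  then obtain a b M where LM: "L = a # b # M"
    by (cases L; cases "tl L") auto
  define z where "z = last L"
  have z: "z \<in> A" "a \<in> A" "a \<noteq> z"
    using L(2,3) LM last_in_set[of L] last_in_set[of "b # M"] by (auto simp: z_def)
  have "f a \<le> f z"
    using L(1) LM last_in_set[of "b # M"] by (auto simp: z_def)
  have "2 * sum_list (map h L) \<le> f z - f a + h a + h z"
    unfolding z_def LM
  proof (rule sum_list_weights_le_sorted)
    fix b' c assume "b' \<in> set (a # b # M)" "c \<in> set (a # b # M)" "b' \<noteq> c"
    then have "h b' + h c < rho (x b') (x c)"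
      using L(3) LM less by auto
    also have "\<dots> \<le> \<bar>f b' - f c\<bar>"
      using rho_abs_circle_le[of 0 "f b'" "f c"] by (simp add: f)
    finally show "h b' + h c \<le> \<bar>f b' - f c\<bar>"
      by simp
  qed (use L LM in auto)
  \<comment> \<open>This is the arc from the last point across 0 to the first: the integer -1 turns
    \<open>f a - f z\<close> into its length. It closes the circle and supplies the strict
    inequality.\<close>
  moreover have "h a + h z < 1 - (f z - f a)"
    using less[OF z(2,1,3)] rho_abs_circle_le[of "-1" "f a" "f z"] f(1,2)[of a] f(1,2)[of z]
      f(3)[of a] f(3)[of z] by auto
  moreover have "sum_list (map h L) = (\<Sum>a\<in>A. h a)"
    using L by (simp add: sum_list_distinct_conv_sum_set)
  ultimately show ?thesis
    by simp
qed

lemma min_gap_le_rho: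
  assumes "a \<in> {1..n}" "b \<in> {1..n}" "a \<noteq> b"
  shows "min_gap x n \<le> rho (x a) (x b)"
proof -
  define S where "S = {rho (x r) (x s) | r s. 1 \<le> r \<and> r < s \<and> s \<le> n}"
  have "S \<subseteq> (\<lambda>(r, s). rho (x r) (x s)) ` ({1..n} \<times> {1..n})"
    by (auto simp: S_def)
  then have "finite S"
    by (rule finite_subset) auto
  moreover have "rho (x a) (x b) \<in> S"
  proof (cases "a < b")
    case True
    then show ?thesis
      using assms by (auto simp: S_def)
  next
    case False
    then have "rho (x b) (x a) \<in> S"
      unfolding S_def using assms by (intro CollectI exI[of _ b] exI[of _ a]) auto
    then show ?thesis
      by (simp add: rho_commute)
  qed
  ultimately show ?thesis
    by (simp add: min_gap_def S_def)
qed

lemma phi_antimono: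
  assumes "1 \<le> m" "m \<le> n"
  shows "phi n \<le> phi m"
proof -
  have "ln (real n + 1) + ln (real m) = ln ((real n + 1) * real m)"
    using assms by (simp add: ln_mult)
  \<comment> \<open>This is \<open>1 + 1/n \<le> 1 + 1/m\<close> with denominators cleared.\<close>
  also have "\<dots> \<le> ln ((real m + 1) * real n)"
    using assms by (intro ln_mono) (auto simp: algebra_simps intro: add_pos_nonneg)
  also have "\<dots> = ln (real m + 1) + ln (real n)"
    using assms by (simp add: ln_mult)
  finally show ?thesis
    by (simp add: phi_def divide_right_mono)
qed

lemma sum_phi:
  assumes "1 \<le> m" "m \<le> n"
  shows "(\<Sum>k=m..<n. phi k) = (ln (real n) - ln (real m)) / (2 * ln 2)"
  using sum_Suc_diff'[OF assms(2), of "\<lambda>k. ln (real k)"]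
  by (simp add: phi_def add.commute flip: sum_divide_distrib)

theorem theorem2:
  fixes x :: "nat \<Rightarrow> circle"
  shows "infinite {n. 2 \<le> n \<and> min_gap x n \<le> phi (n - 1)}"
proof
  assume "finite {n. 2 \<le> n \<and> min_gap x n \<le> phi (n - 1)}"
  then obtain N where N: "\<And>n. 2 \<le> n \<Longrightarrow> min_gap x n \<le> phi (n - 1) \<Longrightarrow> n \<le> N"
    unfolding finite_nat_set_iff_bounded_le by auto
  \<comment> \<open>The successor makes \<open>n\<close> positive, so that \<open>ln n\<close>
    behaves and there are at least two points among \<open>2 * n\<close>.\<close>
  define n where "n = Suc N"
  have "n \<ge> 1"
    by (simp add: n_def)
  have large: "phi (k - 1) < min_gap x k" if "n < k" for k
    using N[of k] that by (force simp: n_def)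
  define t where "t = phi n"
  define h where "h k = (if k \<le> n then t / 2 else phi (k - 1) - t / 2)" for k
  have "h a + h b < rho (x a) (x b)" if ab: "a \<in> {1..2*n}" "b \<in> {1..2*n}" "a \<noteq> b" for a b
  proof -
    define K where "K = max (max a b) (Suc n)"
    have phi_le: "phi (k - 1) \<le> t" if "n < k" for k
      unfolding t_def using that \<open>n \<ge> 1\<close> by (intro phi_antimono) auto
    \<comment> \<open>Equality holds unless both indices exceed \<open>n\<close>; then the smaller
      index contributes \<open>phi\<close> of its predecessor, at most \<open>t\<close>, and the two
      halves of \<open>t\<close> are subtracted.\<close>
    have "h a + h b \<le> phi (K - 1)"
      using phi_le[of a] phi_le[of b]
      by (cases "a \<le> n"; cases "b \<le> n") (auto simp: h_def K_def max_def t_def)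
    also have "\<dots> < min_gap x K"
      by (rule large) (auto simp: K_def)
    also have "\<dots> \<le> rho (x a) (x b)"
      using ab by (intro min_gap_le_rho) (auto simp: K_def)
    finally show ?thesis .
  qed
  then have "2 * (\<Sum>k\<in>{1..2*n}. h k) < 1"
    using \<open>n \<ge> 1\<close> by (intro sum_weights_less_of_rho[where x = x]) auto
  moreover have "(\<Sum>k\<in>{1..2*n}. h k) = (\<Sum>k\<in>{1..n}. h k) + (\<Sum>k\<in>{n+1..2*n}. h k)"
    using sum.ub_add_nat[of 1 n h n] by (simp add: mult_2)
  \<comment> \<open>Both halves of the index range have \<open>n\<close> elements, so the terms
    \<open>t / 2\<close> cancel in the total.\<close>
  moreover have "(\<Sum>k\<in>{1..n}. h k) = real n * (t / 2)"
    by (simp add: h_def)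
  moreover have "(\<Sum>k\<in>{n+1..2*n}. h k) = (\<Sum>k=n..<2*n. phi k - t / 2)"
    by (rule sum.reindex_bij_witness[of _ Suc "\<lambda>k. k - 1"]) (auto simp: h_def)
  moreover have "\<dots> = (\<Sum>k=n..<2*n. phi k) - real n * (t / 2)"
    by (simp add: sum_subtractf)
  moreover have "(\<Sum>k=n..<2*n. phi k) = 1 / 2"
    using sum_phi[of n "2 * n"] \<open>n \<ge> 1\<close> by (simp add: ln_mult)
  ultimately show False
    by simp
qed

end
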